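(* Let $\Gamma$ be the dual graph of a good resolution of a complex normal surface singularity whose link is a rational homology sphere. Let $Z\in\mathcal E^+\setminus\{0\}$ and let $D\in\mathcal G$ with $D\ge 0$. Then the (virtual) genera satisfy $$g(Z)\le g(Z+D).$$
   Context: Let $E=\sum_{i=1}^nE_i$ be the exceptional curve of the good resolution, with irreducible components $E_i$. Since the link is a rational homology sphere, each $E_i$ is a smooth rational curve and $\Gamma$ is a connected tree. $\mathcal G=\bigoplus_{i=1}^n\mathbb Z E_i$ carries the negative definite intersection pairing $(\cdot,\cdot)$ and the coefficientwise partial order. The Lipman cone is $\mathcal E^+=\{D\in\mathcal G:(D,E_i)\le 0\text{ for all }i\}$; every nonzero element of it has all coefficients strictly positive. The canonical cycle $K\in\mathcal G\otimes\mathbb Q$ is defined by $(K+E_i,E_i)+2=0$ for all $i$, and for $D\in\mathcal G$, $\chi(D)=-\tfrac12(D,D+K)\in\mathbb Z$. For $D=\sum_i m_iE_i\in\mathcal G$ let $|D|=\sum_{i:\,m_i\ne0}E_i$ be its support and $\#(D)$ the number of connected components of $|D|$ (so $\#(0)=0$). For $D\ge0$ the virtual genus is $$g(D)=\#(D)+(D,|D|)+\chi(-D).$$ For $Z\in\mathcal E^+\setminus\{0\}$ this coincides with the page-genus of the Milnor open book associated with $Z$. *)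

theory Defs
  imports "HOL-Analysis.Analysis"
begin

text \<open>
  The dual graph of a good resolution whose link is a rational homology sphere, as combinatorial
  data: the vertex type \<open>'v\<close> indexes the exceptional components \<open>E\<^sub>v\<close>, \<open>adj\<close> is the set of
  (ordered) pairs of distinct intersecting components, \<open>selfint v\<close> is \<open>(E\<^sub>v, E\<^sub>v)\<close>. All genera are
  zero and therefore not recorded.

  Cycles \<open>\<Sum>\<^sub>v m\<^sub>v E\<^sub>v\<close> are vectors: the lattice is \<open>int ^ 'v\<close>, its rationalization is \<open>rat ^ 'v\<close>,
  and \<open>E\<^sub>v\<close> is \<open>axis v 1\<close>. The order on \<open>int ^ 'v\<close> is the coefficientwise one.
\<close>

record 'v dual_graph =
  adj :: "('v \<times> 'v) set"
  selfint :: "'v \<Rightarrow> int"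

definition intersection :: "'v dual_graph \<Rightarrow> 'v \<Rightarrow> 'v \<Rightarrow> int" where
  "intersection \<Gamma> i j =
     (if i = j then selfint \<Gamma> i else if (i, j) \<in> adj \<Gamma> then 1 else 0)"

definition pairing :: "'v::finite dual_graph \<Rightarrow> 'a::comm_ring_1 ^ 'v \<Rightarrow> 'a ^ 'v \<Rightarrow> 'a" where
  "pairing \<Gamma> x y = (\<Sum>i\<in>UNIV. \<Sum>j\<in>UNIV. of_int (intersection \<Gamma> i j) * x $ i * y $ j)"

definition is_cycle :: "('v \<times> 'v) set \<Rightarrow> 'v list \<Rightarrow> bool" where
  "is_cycle A vs \<longleftrightarrow> length vs \<ge> 3 \<and> distinct vs \<and>
     (\<forall>k < length vs. (vs ! k, vs ! (Suc k mod length vs)) \<in> A)"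

definition is_tree :: "('v \<times> 'v) set \<Rightarrow> bool" where
  "is_tree A \<longleftrightarrow> sym A \<and> irrefl A \<and> A\<^sup>* = UNIV \<and> (\<nexists>vs. is_cycle A vs)"

text \<open>
  By Grauert's theorem every negative definite graph of this kind is realized by a good resolution,
  so these conditions characterize the dual graphs in question.
\<close>

definition resolution_graph :: "'v::finite dual_graph \<Rightarrow> bool" where
  "resolution_graph \<Gamma> \<longleftrightarrow> is_tree (adj \<Gamma>) \<and> (\<forall>D :: int ^ 'v. D \<noteq> 0 \<longrightarrow> pairing \<Gamma> D D < 0)"

definition lipman_cone :: "'v::finite dual_graph \<Rightarrow> (int ^ 'v) set" where
  "lipman_cone \<Gamma> = {D. \<forall>i. pairing \<Gamma> D (axis i 1) \<le> 0}"

definition canonical_cycle :: "'v::finite dual_graph \<Rightarrow> rat ^ 'v" where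
  "canonical_cycle \<Gamma> = (THE K. \<forall>i. pairing \<Gamma> (K + axis i 1) (axis i 1) + 2 = 0)"

definition rat_cycle :: "int ^ 'v \<Rightarrow> rat ^ 'v" where
  "rat_cycle D = (\<chi> i. of_int (D $ i))"

definition euler_char :: "'v::finite dual_graph \<Rightarrow> int ^ 'v \<Rightarrow> rat" where
  "euler_char \<Gamma> D =
     - (1/2) * pairing \<Gamma> (rat_cycle D) (rat_cycle D + canonical_cycle \<Gamma>)"

definition supp_set :: "int ^ 'v \<Rightarrow> 'v set" where
  "supp_set D = {i. D $ i \<noteq> 0}"

definition supp_cycle :: "int ^ 'v \<Rightarrow> int ^ 'v" where
  "supp_cycle D = (\<chi> i. if i \<in> supp_set D then 1 else 0)"

text \<open>Connected components are the classes of reachability inside the support.\<close>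

definition num_components :: "'v::finite dual_graph \<Rightarrow> int ^ 'v \<Rightarrow> nat" where
  "num_components \<Gamma> D = card (supp_set D // (Restr (adj \<Gamma>) (supp_set D))\<^sup>*)"

definition virtual_genus :: "'v::finite dual_graph \<Rightarrow> int ^ 'v \<Rightarrow> rat" where
  "virtual_genus \<Gamma> D =
     of_nat (num_components \<Gamma> D) + of_int (pairing \<Gamma> D (supp_cycle D)) + euler_char \<Gamma> (- D)"

text \<open>The adjunction equations have exactly one solution, so \<open>canonical_cycle\<close> is well defined.\<close>

lemma pairing_add_left: "pairing \<Gamma> (x + y) z = pairing \<Gamma> x z + pairing \<Gamma> y z"
  by (simp add: pairing_def algebra_simps sum.distrib)

lemma pairing_axis_right:
  "pairing \<Gamma> x (axis j 1) = (\<Sum>i\<in>UNIV. of_int (intersection \<Gamma> i j) * x $ i)"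
  by (simp add: pairing_def axis_def if_distrib[of "\<lambda>t. _ * t"] cong: if_cong)

lemma clear_denominators:
  fixes x :: "rat ^ 'v::finite"
  shows "\<exists>(d::int) y. d > 0 \<and> rat_cycle y = of_int d *s x"
proof -
  define q where "q i = snd (quotient_of (x $ i))" for i
  define d where "d = (\<Prod>i\<in>UNIV. q i)"
  have q: "q i > 0" for i
    by (simp add: q_def quotient_of_denom_pos')
  have "\<exists>m::int. of_int m = of_int d * x $ i" for i
  proof -
    have x: "x $ i = of_int (fst (quotient_of (x $ i))) / of_int (q i)"
      unfolding q_def by (rule quotient_of_div) simp
    have "q i dvd d"
      unfolding d_def by (rule dvd_prodI) auto
    then obtain k where "d = q i * k" ..
    then have "of_int (k * fst (quotient_of (x $ i))) = of_int d * x $ i"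
      using q[of i] by (subst x) simp
    then show ?thesis ..
  qed
  then obtain m where "of_int (m i) = of_int d * x $ i" for i :: 'v
    by metis
  then have "rat_cycle (\<chi> i. m i) = of_int d *s x"
    by (simp add: rat_cycle_def vec_eq_iff)
  moreover have "d > 0"
    unfolding d_def by (simp add: prod_pos q)
  ultimately show ?thesis by blast
qed

lemma canonical_cycle_unique:
  assumes \<Gamma>: "resolution_graph (\<Gamma> :: 'v::finite dual_graph)"
  shows "\<exists>!K :: rat ^ 'v. \<forall>i. pairing \<Gamma> (K + axis i 1) (axis i 1) + 2 = 0"
proof -
  define M :: "rat ^ 'v ^ 'v" where "M = (\<chi> j i. of_int (intersection \<Gamma> i j))"
  define b :: "rat ^ 'v" where "b = (\<chi> i. - 2 - of_int (selfint \<Gamma> i))"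
  have Mv: "(M *v x) $ j = pairing \<Gamma> x (axis j 1)" for x j
    by (simp add: M_def matrix_vector_mult_def pairing_axis_right)
  have ax: "pairing \<Gamma> (axis i 1) (axis i 1) = (of_int (selfint \<Gamma> i) :: rat)" for i
    unfolding pairing_axis_right
    by (simp add: axis_def intersection_def if_distrib[of "\<lambda>t. _ * t"] cong: if_cong)
  have eq: "(\<forall>i. pairing \<Gamma> (K + axis i 1) (axis i 1) + 2 = 0) \<longleftrightarrow> M *v K = b" for K
  proof -
    have "pairing \<Gamma> (K + axis i 1) (axis i 1) + 2 = 0 \<longleftrightarrow> (M *v K) $ i = b $ i" for i
      unfolding pairing_add_left ax Mv by (simp add: b_def) linarith
    then show ?thesis by (simp add: vec_eq_iff)
  qed
  have ker: "x = 0" if "M *v x = 0" for x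
  proof -
    obtain d y where d: "d > 0" and y: "rat_cycle y = of_int d *s x"
      using clear_denominators by blast
    have My: "M *v rat_cycle y = 0"
      unfolding y vector_scalar_commute that by simp
    have "(of_int (\<Sum>i\<in>UNIV. intersection \<Gamma> i j * y $ i) :: rat) = 0" for j
      using arg_cong[OF My, of "\<lambda>v. v $ j"]
      by (simp add: Mv pairing_axis_right rat_cycle_def)
    then have z: "(\<Sum>i\<in>UNIV. intersection \<Gamma> i j * y $ i) = 0" for j
      by (metis of_int_eq_0_iff)
    have "pairing \<Gamma> y y = (\<Sum>j\<in>UNIV. (\<Sum>i\<in>UNIV. intersection \<Gamma> i j * y $ i) * y $ j)"
      unfolding pairing_def by (subst sum.swap) (simp add: sum_distrib_right)
    also have "\<dots> = 0" by (simp add: z)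
    finally have "y = 0"
      using \<Gamma> unfolding resolution_graph_def by (metis less_irrefl)
    then show "x = 0"
      using y d by (auto simp: rat_cycle_def vec_eq_iff)
  qed
  then have "\<exists>B. B ** M = mat 1"
    by (simp add: matrix_left_invertible_ker)
  then obtain B where B: "B ** M = mat 1" ..
  then have "M ** B = mat 1"
    by (subst matrix_left_right_inverse)
  then have "M *v (B *v b) = b"
    unfolding matrix_vector_mul_assoc by simp
  moreover have "K = B *v b" if "M *v K = b" for K
    unfolding that[symmetric] matrix_vector_mul_assoc B by simp
  ultimately show ?thesis
    unfolding eq by blast
qed

end

theory Submission
  imports Defs
begin

text \<open>
  For \<open>X\<close> of full support, \<open>E\<^sub>i\<close> changes the genus by \<open>g(X + E\<^sub>i) - g(X) = - (X + E\<^sub>i - E, E\<^sub>i) - 1\<close>,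
  so it suffices to descend from \<open>Z + D\<close> to \<open>Z\<close> by removing components \<open>E\<^sub>i\<close> of \<open>D\<close> with
  \<open>(Z + D - E, E\<^sub>i) \<le> -1\<close>. Write \<open>D = |D| + A\<close>. If \<open>A \<noteq> 0\<close>, negative definiteness gives \<open>E\<^sub>i\<close> in
  \<open>|A|\<close> with \<open>(A, E\<^sub>i) \<le> -1\<close>, while \<open>(E - |D|, E\<^sub>i) \<ge> 0\<close> and \<open>(Z, E\<^sub>i) \<le> 0\<close>. If \<open>D = |D|\<close>, take a
  component of \<open>D\<close> meeting \<open>E - D\<close> when \<open>D \<noteq> E\<close>, and one with \<open>(Z, E\<^sub>i) \<le> -1\<close> when \<open>D = E\<close>.
\<close>

section \<open>Algebra of the intersection pairing\<close>

lemma pairing_diff_left: "pairing \<Gamma> (x - y) z = pairing \<Gamma> x z - pairing \<Gamma> y z"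
  by (simp add: pairing_def algebra_simps sum_subtractf)

lemma pairing_add_right: "pairing \<Gamma> x (y + z) = pairing \<Gamma> x y + pairing \<Gamma> x z"
  by (simp add: pairing_def algebra_simps sum.distrib)

lemma pairing_diff_right: "pairing \<Gamma> x (y - z) = pairing \<Gamma> x y - pairing \<Gamma> x z"
  by (simp add: pairing_def algebra_simps sum_subtractf)

lemma pairing_zero_left: "pairing \<Gamma> 0 z = 0"
  by (simp add: pairing_def)

lemma pairing_minus_left: "pairing \<Gamma> (- x) z = - pairing \<Gamma> x z"
  by (simp add: pairing_def sum_negf)

lemma pairing_eq_sum_axis:
  "pairing \<Gamma> x y = (\<Sum>j\<in>UNIV. pairing \<Gamma> x (axis j 1) * y $ j)"
  unfolding pairing_axis_right by (subst pairing_def, subst sum.swap) (simp add: sum_distrib_right)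

lemma pairing_commute:
  assumes "sym (adj \<Gamma>)"
  shows "pairing \<Gamma> x y = pairing \<Gamma> y x"
proof -
  have "intersection \<Gamma> i j = intersection \<Gamma> j i" for i j
    using assms by (auto simp: intersection_def dest: symD)
  then show ?thesis
    unfolding pairing_def by (subst sum.swap) (simp add: mult_ac)
qed

lemma pairing_rat_cycle:
  "pairing \<Gamma> (rat_cycle x) (rat_cycle y) = of_int (pairing \<Gamma> x y)"
  by (simp add: pairing_def rat_cycle_def)

lemma rat_cycle_add: "rat_cycle (x + y) = rat_cycle x + rat_cycle y"
  by (simp add: rat_cycle_def vec_eq_iff)

lemma rat_cycle_minus: "rat_cycle (- x) = - rat_cycle x"
  by (simp add: rat_cycle_def vec_eq_iff)

lemma rat_cycle_axis: "rat_cycle (axis i 1) = axis i 1"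
  by (simp add: rat_cycle_def vec_eq_iff axis_def)

text \<open>Only the self-intersection can be negative, and its coefficient \<open>x $ i\<close>
  vanishes; the neighbour \<open>j\<close> then contributes \<open>x $ j\<close>.\<close>

lemma pairing_axis_ge:
  fixes x :: "int ^ 'v::finite"
  assumes "\<And>k. 0 \<le> x $ k" and "x $ i = 0" and "(j, i) \<in> adj \<Gamma>"
  shows "x $ j \<le> pairing \<Gamma> x (axis i 1)"
proof (cases "j = i")
  case True
  have "0 \<le> intersection \<Gamma> k i * x $ k" for k
    using assms by (auto simp: intersection_def)
  then show ?thesis
    using True assms by (simp add: pairing_axis_right sum_nonneg)
next
  case False
  have "0 \<le> intersection \<Gamma> k i * x $ k" for k
    using assms by (auto simp: intersection_def)
  then have "intersection \<Gamma> j i * x $ j \<le> (\<Sum>k\<in>UNIV. intersection \<Gamma> k i * x $ k)"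
    by (intro member_le_sum) auto
  then show ?thesis
    using False assms by (simp add: pairing_axis_right intersection_def)
qed

lemma pairing_axis_nonneg:
  fixes x :: "int ^ 'v::finite"
  assumes "\<And>k. 0 \<le> x $ k" and "x $ i = 0"
  shows "0 \<le> pairing \<Gamma> x (axis i 1)"
proof -
  have "0 \<le> intersection \<Gamma> k i * x $ k" for k
    using assms by (auto simp: intersection_def)
  then show ?thesis
    by (simp add: pairing_axis_right sum_nonneg)
qed

text \<open>A path from \<open>i\<close> to \<open>j\<close> must leave \<open>S\<close>. With
  \<open>S\<close> a support, this yields a component of the cycle meeting one outside it.\<close>

lemma boundary_edge:
  assumes "A\<^sup>* = UNIV" and "i \<in> S" and "j \<notin> S"
  obtains k l where "k \<in> S" "l \<notin> S" "(k, l) \<in> A"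
proof -
  have "(i, j) \<in> A\<^sup>*" using assms(1) by simp
  then have "\<exists>k l. k \<in> S \<and> l \<notin> S \<and> (k, l) \<in> A"
    using assms(3) by induction (use assms(2) in blast)+
  then show thesis using that by blast
qed

section \<open>Consequences of negative definiteness and connectedness\<close>

context
  fixes \<Gamma> :: "'v::finite dual_graph"
  assumes graph: "resolution_graph \<Gamma>"
begin

lemma adj_sym: "sym (adj \<Gamma>)"
  using graph by (simp add: resolution_graph_def is_tree_def)

lemma adj_connected: "(adj \<Gamma>)\<^sup>* = UNIV"
  using graph by (simp add: resolution_graph_def is_tree_def)

lemma pairing_negative: "D \<noteq> 0 \<Longrightarrow> pairing \<Gamma> D D < (0::int)"
  using graph by (simp add: resolution_graph_def)

text \<open>Expanding the second argument of \<open>pairing \<Gamma> A A < 0\<close> along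
  components gives a negative summand; since \<open>A\<close> is effective, its sign comes from the
  pairing factor.\<close>

lemma exists_negative_component:
  fixes A :: "int ^ 'v"
  assumes "\<And>k. 0 \<le> A $ k" and "A \<noteq> 0"
  obtains i where "0 < A $ i" "pairing \<Gamma> A (axis i 1) < 0"
proof -
  have "\<exists>i. pairing \<Gamma> A (axis i 1) * A $ i < 0"
    using pairing_negative[OF assms(2)] unfolding pairing_eq_sum_axis[of \<Gamma> A A]
    by (meson not_less sum_nonneg)
  then show thesis
    using that assms(1) by (metis mult_less_0_iff not_less)
qed

text \<open>If the negative part \<open>N\<close> were nonzero, some component of \<open>N\<close>
  would pair negatively with it. The positive part \<open>P\<close> does not contain that component,
  so \<open>P - N\<close> would pair positively with it.\<close>

lemma lipman_cone_nonneg: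
  assumes "Z \<in> lipman_cone \<Gamma>"
  shows "0 \<le> Z $ i"
proof -
  define P :: "int ^ 'v" where "P = (\<chi> k. max (Z $ k) 0)"
  define N :: "int ^ 'v" where "N = (\<chi> k. max (- Z $ k) 0)"
  have Z: "Z = P - N"
    by (simp add: P_def N_def vec_eq_iff max_def)
  have "N = 0"
  proof (rule ccontr)
    assume "N \<noteq> 0"
    then obtain k where k: "0 < N $ k" "pairing \<Gamma> N (axis k 1) < 0"
      by (rule exists_negative_component[rotated]) (auto simp: N_def)
    have "0 \<le> pairing \<Gamma> P (axis k 1)"
      using k(1) by (intro pairing_axis_nonneg) (auto simp: P_def N_def max_def split: if_splits)
    then have "0 < pairing \<Gamma> Z (axis k 1)"
      using k(2) by (simp add: Z pairing_diff_left)
    then show False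
      using assms by (auto simp: lipman_cone_def not_less[symmetric])
  qed
  then have "Z $ i = P $ i"
    using Z by simp
  then show ?thesis
    by (simp add: P_def)
qed

text \<open>Otherwise connectedness gives a component outside the support but meeting it, and this
  pairs positively with \<open>Z\<close>.\<close>

lemma lipman_cone_pos:
  assumes "Z \<in> lipman_cone \<Gamma> - {0}"
  shows "0 < Z $ i"
proof (rule ccontr)
  assume "\<not> 0 < Z $ i"
  moreover have nonneg: "0 \<le> Z $ k" for k
    using assms lipman_cone_nonneg by simp
  ultimately have "Z $ i = 0"
    by (metis less_le)
  moreover obtain j where "Z $ j \<noteq> 0"
    using assms by (auto simp: vec_eq_iff)
  ultimately obtain k l where "Z $ k \<noteq> 0" "Z $ l = 0" "(k, l) \<in> adj \<Gamma>"
    using boundary_edge[OF adj_connected, of j "{k. Z $ k \<noteq> 0}" i] by auto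
  then have "0 < pairing \<Gamma> Z (axis l 1)"
    using pairing_axis_ge[OF nonneg, of l k] nonneg[of k] by force
  then show False
    using assms by (auto simp: lipman_cone_def not_less[symmetric])
qed

section \<open>Change of the genus when a component is added\<close>

lemma pairing_axis_canonical:
  "pairing \<Gamma> (axis i 1) (canonical_cycle \<Gamma>) = - 2 - of_int (pairing \<Gamma> (axis i 1) (axis i 1))"
proof -
  have "pairing \<Gamma> (canonical_cycle \<Gamma> + axis i 1) (axis i 1) + 2 = 0"
    unfolding canonical_cycle_def using theI'[OF canonical_cycle_unique[OF graph]] by blast
  moreover have "pairing \<Gamma> (axis i 1) (axis i 1) = (of_int (pairing \<Gamma> (axis i 1) (axis i 1)) :: rat)"
    using pairing_rat_cycle[of \<Gamma> "axis i 1" "axis i 1"] by (simp add: rat_cycle_axis)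
  ultimately show ?thesis
    by (simp add: pairing_add_left pairing_commute[OF adj_sym, of _ "canonical_cycle \<Gamma>"])
qed

text \<open>The support is the whole connected curve \<open>1\<close>, so the genus becomes a
  quadratic polynomial in \<open>X\<close>.\<close>

lemma virtual_genus_full_support:
  assumes "\<And>k. 0 < X $ k"
  shows "virtual_genus \<Gamma> X =
    1 + of_int (pairing \<Gamma> X 1) + (pairing \<Gamma> (rat_cycle X) (canonical_cycle \<Gamma>) - of_int (pairing \<Gamma> X X)) / 2"
proof -
  have "X $ k \<noteq> 0" for k
    using assms[of k] by simp
  then have supp: "supp_set X = UNIV"
    by (simp add: supp_set_def)
  have "num_components \<Gamma> X = 1"
    by (simp add: num_components_def supp adj_connected quotient_def Image_def)
  moreover have "supp_cycle X = 1"
    by (simp add: supp_cycle_def supp vec_eq_iff)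
  ultimately show ?thesis
    by (simp add: virtual_genus_def euler_char_def pairing_add_right rat_cycle_minus
        pairing_minus_left pairing_diff_right pairing_rat_cycle field_simps)
qed

lemma virtual_genus_add_axis:
  assumes "\<And>k. 0 < X $ k"
  shows "virtual_genus \<Gamma> (X + axis i 1) =
    virtual_genus \<Gamma> X - of_int (pairing \<Gamma> (X + axis i 1 - 1) (axis i 1)) - 1"
proof -
  have "0 < (X + axis i 1) $ k" for k
    using assms[of k] by (auto simp: axis_def)
  then show ?thesis
    using assms
    by (simp add: virtual_genus_full_support pairing_add_left pairing_add_right pairing_diff_left
        rat_cycle_add rat_cycle_axis pairing_axis_canonical pairing_commute[OF adj_sym, of "axis i 1" X]
        pairing_commute[OF adj_sym, of "axis i 1" 1] field_simps)
qed

section \<open>Descent from \<open>Z + D\<close> to \<open>Z\<close>\<close>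

lemma exists_descent_component:
  fixes Z D :: "int ^ 'v"
  assumes Z: "Z \<in> lipman_cone \<Gamma> - {0}" and D: "\<And>k. 0 \<le> D $ k" and "D \<noteq> 0"
  obtains i where "0 < D $ i" "pairing \<Gamma> (Z + D - 1) (axis i 1) < 0"
proof -
  define A where "A = D - supp_cycle D"
  define B where "B = 1 - supp_cycle D"
  have split: "pairing \<Gamma> (Z + D - 1) y = pairing \<Gamma> Z y + pairing \<Gamma> A y - pairing \<Gamma> B y" for y
    by (simp add: A_def B_def pairing_add_left pairing_diff_left)
  have Zle: "pairing \<Gamma> Z (axis i 1) \<le> 0" for i
    using Z by (simp add: lipman_cone_def)
  have A: "0 \<le> A $ k" for k
    using D[of k] by (auto simp: A_def supp_cycle_def supp_set_def)
  have Bk: "B $ k = (if D $ k = 0 then 1 else 0)" for k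
    by (simp add: B_def supp_cycle_def supp_set_def)
  \<comment> \<open>Components of \<open>D\<close> do not occur in \<open>B\<close>, so the term
    subtracted in \<open>split\<close> is harmless there.\<close>
  have B: "0 \<le> pairing \<Gamma> B (axis i 1)" if "0 < D $ i" for i
    using that by (intro pairing_axis_nonneg) (simp_all add: Bk)
  consider (nonreduced) "A \<noteq> 0" | (proper) j where "A = 0" "D $ j = 0" | (full) "A = 0" "\<And>k. D $ k \<noteq> 0"
    by blast
  then show thesis
  proof cases
    case nonreduced
    then obtain i where i: "0 < A $ i" "pairing \<Gamma> A (axis i 1) < 0"
      using exists_negative_component[OF A] by blast
    then have "0 < D $ i"
      using D[of i] by (auto simp: A_def supp_cycle_def supp_set_def split: if_splits)
    with that[of i] i B[of i] Zle[of i] show thesis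
      by (simp add: split)
  next
    case proper
    obtain m where "D $ m \<noteq> 0"
      using \<open>D \<noteq> 0\<close> by (auto simp: vec_eq_iff)
    then obtain k l where kl: "D $ k \<noteq> 0" "D $ l = 0" "(k, l) \<in> adj \<Gamma>"
      using boundary_edge[OF adj_connected, of m "{k. D $ k \<noteq> 0}" j] proper by auto
    \<comment> \<open>Here \<open>B $ l = 1\<close>, which supplies the strict inequality;
      \<open>pairing_axis_ge\<close> takes the edge from \<open>l\<close> to \<open>k\<close>, hence
      the symmetry.\<close>
    then have "B $ l \<le> pairing \<Gamma> B (axis k 1)"
      using adj_sym by (intro pairing_axis_ge) (auto simp: Bk dest: symD)
    moreover have "0 < D $ k"
      using kl(1) D[of k] by simp
    ultimately show thesis
      using that[of k] Zle[of k] kl proper(1) by (simp add: split Bk pairing_zero_left)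
  next
    case full
    then have "B = 0"
      by (simp add: vec_eq_iff Bk)
    \<comment> \<open>Now \<open>Z + D - 1\<close> is \<open>Z\<close> itself, so definiteness is
      applied to \<open>Z\<close>.\<close>
    have "0 \<le> Z $ k" "Z \<noteq> 0" for k
      using Z lipman_cone_nonneg by auto
    then obtain i where "pairing \<Gamma> Z (axis i 1) < 0"
      by (rule exists_negative_component)
    moreover have "0 < D $ i"
      using full(2)[of i] D[of i] by simp
    ultimately show thesis
      by (intro that[of i]) (simp_all add: split full(1) \<open>B = 0\<close> pairing_zero_left)
  qed
qed

lemma virtual_genus_mono:
  fixes Z D :: "int ^ 'v"
  assumes Z: "Z \<in> lipman_cone \<Gamma> - {0}" and "\<And>k. 0 \<le> D $ k"
  shows "virtual_genus \<Gamma> Z \<le> virtual_genus \<Gamma> (Z + D)"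
  using assms(2)
proof (induction "nat (\<Sum>k\<in>UNIV. D $ k)" arbitrary: D rule: less_induct)
  case less
  show ?case
  proof (cases "D = 0")
    case False
    then obtain i where i: "0 < D $ i" "pairing \<Gamma> (Z + D - 1) (axis i 1) < 0"
      using exists_descent_component[OF Z less.prems] by blast
    define D' where "D' = D - axis i 1"
    have D: "D = D' + axis i 1"
      by (simp add: D'_def)
    have D': "0 \<le> D' $ k" for k
      using i(1) less.prems[of k] by (auto simp: D'_def axis_def)
    have "(\<Sum>k\<in>UNIV. D $ k) = (\<Sum>k\<in>UNIV. D' $ k) + 1"
      by (simp add: D sum.distrib axis_def)
    moreover have "0 \<le> (\<Sum>k\<in>UNIV. D' $ k)"
      by (simp add: D' sum_nonneg)
    ultimately have "virtual_genus \<Gamma> Z \<le> virtual_genus \<Gamma> (Z + D')"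
      by (intro less.hyps D') simp
    also have "\<dots> \<le> virtual_genus \<Gamma> (Z + D)"
    proof -
      \<comment> \<open>Positivity of \<open>Z\<close> keeps the support full throughout the
        descent, as the increment formula requires.\<close>
      have "0 < (Z + D') $ k" for k
        using lipman_cone_pos[OF Z, of k] D'[of k] by simp
      from virtual_genus_add_axis[OF this, of i]
      have "virtual_genus \<Gamma> (Z + D) =
          virtual_genus \<Gamma> (Z + D') - of_int (pairing \<Gamma> (Z + D - 1) (axis i 1) + 1)"
        by (simp add: D add.assoc)
      \<comment> \<open>The pairing is a negative integer, hence at most -1, which absorbs the
        constant 1.\<close>
      moreover have "(of_int (pairing \<Gamma> (Z + D - 1) (axis i 1) + 1) :: rat) \<le> 0"
        using i(2) by (subst of_int_le_0_iff) simp
      ultimately show ?thesis by simp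
    qed
    finally show ?thesis .
  qed simp
qed

end

theorem theorem3p3p1:
  fixes \<Gamma> :: "'v::finite dual_graph" and Z D :: "int ^ 'v"
  assumes "resolution_graph \<Gamma>"
    and "Z \<in> lipman_cone \<Gamma> - {0}"
    and "0 \<le> D"
  shows "virtual_genus \<Gamma> Z \<le> virtual_genus \<Gamma> (Z + D)"
  using assms by (intro virtual_genus_mono) (simp_all add: less_eq_vec_def)

end
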